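(* Let $q\in\mathbb N$, let $\mathcal D\subseteq\mathcal W=(\mathbb R^q)^{\mathbb N}$ be a data set, let $$\mathcal M=\{\mathcal B\in\mathsf{LTI}^q : \mathcal D\subseteq\mathcal B\}$$ be the class of models unfalsified by $\mathcal D$, let $L\in\mathbb N$ be a time horizon with $\mathbf L=\{1,\dots,L\}$, and let $*\in\{\kappa,\gamma,\pi\}$. Consider the optimization problems $$\text{(P1)}\quad \underset{\mathcal B\in\mathcal M}{\text{maximize}}\ \ \mu_{*,L}(\mathcal D,\mathcal B)\qquad\text{and}\qquad \text{(P2)}\quad\underset{\mathcal B\in\mathcal M}{\text{minimize}}\ \ d_*\big(\mathcal B_{\mathrm{mpum}}(\mathcal D)|_{\mathbf L},\mathcal B|_{\mathbf L}\big)^2.$$ Then $\mathcal B_{\mathrm{mpum}}(\mathcal D)$ is an optimizer of (P1) and of (P2). Moreover, any optimizer $\mathcal B\in\mathcal M$ of (P1) or (P2) satisfies $$\mathcal B|_{\mathbf L}=\mathcal B_{\mathrm{mpum}}(\mathcal D)|_{\mathbf L}.$$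
   Context: $\mathbb N$ is the set of positive integers. $\mathsf{LTI}^q$ is the set of all discrete-time, complete, linear time-invariant systems with $q$ variables, i.e. linear subspaces $\mathcal B\subseteq\mathcal W=(\mathbb R^q)^{\mathbb N}$ that are closed in the topology of pointwise convergence and satisfy $\sigma\mathcal B\subseteq\mathcal B$, where $(\sigma w)_t=w_{t+1}$. For $t\in\mathbb N$, $\mathbf t=\{1,\dots,t\}$ and $\mathcal B|_{\mathbf t}=\{w|_{\mathbf t}:w\in\mathcal B\}$, viewed as a linear subspace of $\mathbb R^{qt}$ by stacking. The complexity is $c_t(\mathcal B)=\dim\mathcal B|_{\mathbf t}/(qt)$. The most powerful unfalsified model $\mathcal B_{\mathrm{mpum}}(\mathcal D)$ in the model class $\mathsf{LTI}^q$ based on $\mathcal D$ is the unique $\mathcal B_{\mathrm{mpum}}(\mathcal D)\in\mathsf{LTI}^q$ with $\mathcal D\subseteq\mathcal B_{\mathrm{mpum}}(\mathcal D)$ and such that $\mathcal B\in\mathsf{LTI}^q$, $\mathcal D\subseteq\mathcal B$ imply $\mathcal B_{\mathrm{mpum}}(\mathcal D)\subseteq\mathcal B$. It always exists and equals $\overline{\operatorname{span}}\{\mathcal D,\sigma\mathcal D,\sigma^2\mathcal D,\dots\}$ (closure of the span in the topology of pointwise convergence). For subspaces $\mathcal V,\mathcal U$ of $\mathbb R^N$ with $k=\dim\mathcal V$, $l=\dim\mathcal U$ and principal angles $\theta_i=\theta_i(\mathcal V,\mathcal U)\in[0,\pi/2]$, $i=1,\dots,\min(k,l)$, define (empty sums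 being $0$) $$d_\kappa=\Big(|k-l|+\sum_{i}(\sin\theta_i)^2\Big)^{1/2},\quad d_\gamma=\Big(|k-l|\tfrac{\pi^2}{4}+\sum_{i}\theta_i^2\Big)^{1/2},\quad d_\pi=\Big(|k-l|+2\sum_{i}\big(\sin\tfrac{\theta_i}{2}\big)^2\Big)^{1/2},$$ $$\delta_\kappa=\Big(\sum_{i}(\sin\theta_i)^2\Big)^{1/2},\quad \delta_\gamma=\Big(\sum_{i}\theta_i^2\Big)^{1/2},\quad \delta_\pi=\Big(2\sum_{i}\big(\sin\tfrac{\theta_i}{2}\big)^2\Big)^{1/2},$$ all sums over $i=1,\dots,\min(k,l)$ and all quantities evaluated at $(\mathcal V,\mathcal U)$, and $\alpha_\kappa=1$, $\alpha_\gamma=\pi/2$, $\alpha_\pi=1$. The utility function is $$\mu_{*,L}(\mathcal D,\mathcal B)=-\delta_*\big(\mathcal B_{\mathrm{mpum}}(\mathcal D)|_{\mathbf L},\mathcal B|_{\mathbf L}\big)^2-\alpha_*^2\,qL\,\big|c_L(\mathcal B_{\mathrm{mpum}}(\mathcal D))-c_L(\mathcal B)\big|.$$ *)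

theory Defs
  imports "HOL-Analysis.Analysis" "HOL-Library.Function_Algebras"
begin

text \<open>Functions into a real vector space form a real vector space pointwise. The product topology
  on function types (the topology of pointwise convergence) comes from HOL-Analysis.\<close>

instantiation "fun" :: (type, real_vector) real_vector
begin

definition scaleR_fun :: "real \<Rightarrow> ('a \<Rightarrow> 'b) \<Rightarrow> 'a \<Rightarrow> 'b"
  where "scaleR_fun c f = (\<lambda>x. c *\<^sub>R f x)"

instance
  by standard (simp_all add: scaleR_fun_def plus_fun_def fun_eq_iff algebra_simps)

end

text \<open>The number of variables is \<open>q = CARD('q)\<close>. Time is counted from 0 instead of 1:
  for a trajectory \<open>w :: nat \<Rightarrow> real ^ 'q\<close>, the vector \<open>w n\<close> is the value at time \<open>n + 1\<close>.\<close>

definition shift :: "(nat \<Rightarrow> 'a) \<Rightarrow> nat \<Rightarrow> 'a"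
  where "shift w = (\<lambda>t. w (Suc t))"

definition LTI :: "(nat \<Rightarrow> real ^ 'q) set set"
  where "LTI = {B. subspace B \<and> closed B \<and> shift ` B \<subseteq> B}"

definition unfalsified :: "(nat \<Rightarrow> real ^ 'q) set \<Rightarrow> (nat \<Rightarrow> real ^ 'q) set set"
  where "unfalsified D = {B \<in> LTI. D \<subseteq> B}"

definition mpum :: "(nat \<Rightarrow> real ^ 'q) set \<Rightarrow> (nat \<Rightarrow> real ^ 'q) set"
  where "mpum D = (THE B. B \<in> LTI \<and> D \<subseteq> B \<and> (\<forall>B'\<in>LTI. D \<subseteq> B' \<longrightarrow> B \<subseteq> B'))"

text \<open>A time horizon \<open>L \<ge> 1\<close> is represented by a finite linearly ordered type \<open>'l\<close> with
  \<open>L = CARD('l)\<close>, so that \<open>('q, 'l) window\<close> is the Euclidean space of dimension \<open>q L\<close>. The element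
  \<open>i :: 'l\<close> with exactly \<open>n\<close> predecessors stands for the time instant \<open>n + 1\<close>.\<close>

type_synonym ('q, 'l) window = "((real, 'q) vec, 'l) vec"

definition restr :: "(nat \<Rightarrow> real ^ 'q) set \<Rightarrow> ('q, 'l::{finite,linorder}) window set"
  where "restr B = (\<lambda>w. \<chi> i. w (card {j. j < i})) ` B"

definition complexity :: "'l::{finite,linorder} itself \<Rightarrow> (nat \<Rightarrow> real ^ 'q) set \<Rightarrow> real"
  where "complexity (_ :: 'l itself) B =
    real (dim (restr B :: ('q, 'l) window set)) / real (CARD('q) * CARD('l))"

text \<open>Principal vectors are chosen recursively: the \<open>i\<close>-th pair maximizes the inner product among all
  pairs of unit vectors orthogonal to the previously chosen ones.\<close>

definition principal_vectors ::
    "'a::euclidean_space set \<Rightarrow> 'a set \<Rightarrow> (nat \<Rightarrow> 'a) \<Rightarrow> (nat \<Rightarrow> 'a) \<Rightarrow> bool"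
  where "principal_vectors V U v u \<longleftrightarrow>
    (\<forall>i < min (dim V) (dim U).
      is_arg_max (\<lambda>(x, y). x \<bullet> y)
        (\<lambda>(x, y). x \<in> V \<and> y \<in> U \<and> norm x = 1 \<and> norm y = 1 \<and>
                  (\<forall>j<i. x \<bullet> v j = 0 \<and> y \<bullet> u j = 0))
        (v i, u i))"

text \<open>For subspaces \<open>V\<close> and \<open>U\<close>, principal vectors exist, and the angles do not depend on their
  choice (the cosines are the singular values of the orthogonal projection of \<open>V\<close> to \<open>U\<close>).
  Angles are indexed by \<open>i < min (dim V) (dim U)\<close>, starting from 0.\<close>

definition principal_angle :: "'a::euclidean_space set \<Rightarrow> 'a set \<Rightarrow> nat \<Rightarrow> real"
  where "principal_angle V U i =
    (let (v, u) = (SOME (v, u). principal_vectors V U v u) in arccos (v i \<bullet> u i))"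

text \<open>The subscripts \<open>\<kappa>\<close>, \<open>\<gamma>\<close>, \<open>\<pi>\<close> are \<open>Chordal\<close>, \<open>Grassmann\<close>, \<open>Procrustes\<close>, respectively.\<close>

datatype variant = Chordal | Grassmann | Procrustes

fun alpha :: "variant \<Rightarrow> real"
  where
    "alpha Chordal = 1"
  | "alpha Grassmann = pi / 2"
  | "alpha Procrustes = 1"

fun delta :: "variant \<Rightarrow> 'a::euclidean_space set \<Rightarrow> 'a set \<Rightarrow> real"
  where
    "delta Chordal V U =
      sqrt (\<Sum>i<min (dim V) (dim U). (sin (principal_angle V U i))\<^sup>2)"
  | "delta Grassmann V U =
      sqrt (\<Sum>i<min (dim V) (dim U). (principal_angle V U i)\<^sup>2)"
  | "delta Procrustes V U =
      sqrt (2 * (\<Sum>i<min (dim V) (dim U). (sin (principal_angle V U i / 2))\<^sup>2))"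

fun subspace_dist :: "variant \<Rightarrow> 'a::euclidean_space set \<Rightarrow> 'a set \<Rightarrow> real"
  where
    "subspace_dist Chordal V U =
      sqrt (\<bar>real (dim V) - real (dim U)\<bar>
            + (\<Sum>i<min (dim V) (dim U). (sin (principal_angle V U i))\<^sup>2))"
  | "subspace_dist Grassmann V U =
      sqrt (\<bar>real (dim V) - real (dim U)\<bar> * (pi\<^sup>2 / 4)
            + (\<Sum>i<min (dim V) (dim U). (principal_angle V U i)\<^sup>2))"
  | "subspace_dist Procrustes V U =
      sqrt (\<bar>real (dim V) - real (dim U)\<bar>
            + 2 * (\<Sum>i<min (dim V) (dim U). (sin (principal_angle V U i / 2))\<^sup>2))"

definition utility ::
    "variant \<Rightarrow> 'l::{finite,linorder} itself \<Rightarrow> (nat \<Rightarrow> real ^ 'q) set \<Rightarrow> (nat \<Rightarrow> real ^ 'q) set \<Rightarrow> real"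
  where "utility s (_ :: 'l itself) D B =
    - (delta s (restr (mpum D) :: ('q, 'l) window set) (restr B))\<^sup>2
    - (alpha s)\<^sup>2 * real (CARD('q) * CARD('l))
        * \<bar>complexity TYPE('l) (mpum D) - complexity TYPE('l) B\<bar>"

end

theory Submission imports Defs begin

text \<open>The most powerful unfalsified model is the intersection of all unfalsified models
  (\<open>mpum_eq_Inter\<close>) and hence contained in each of them, so after restriction
  to the time horizon one compares a subspace \<open>V\<close> only with subspaces \<open>U \<supseteq> V\<close>. All
  principal angles between nested subspaces vanish (\<open>principal_angle_nested\<close>), because every unit
  vector of \<open>V\<close> can be paired with itself. Hence each of the three squared distances reduces to
  \<open>\<alpha>\<^sup>2 (dim U - dim V)\<close> (\<open>subspace_dist_nested\<close>). This is minimal, namely \<open>0\<close>, exactly if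
  \<open>dim U = dim V\<close>, which for nested subspaces means \<open>U = V\<close>.

  The two optimization problems are the same problem: the utility is minus the squared distance,
  for arbitrary models (\<open>utility_eq_neg_dist\<close>), since \<open>q L\<close> cancels the normalization of the
  complexity and leaves the difference of dimensions. It therefore suffices to treat the distance.\<close>

section \<open>The most powerful unfalsified model\<close>

lemma LTI_Inter:
  assumes "\<A> \<subseteq> LTI"
  shows "\<Inter>\<A> \<in> LTI"
proof -
  have "subspace (\<Inter>\<A>)"
    using assms by (intro subspace_Inter) (auto simp: LTI_def)
  moreover have "closed (\<Inter>\<A>)"
    using assms by (intro closed_Inter) (auto simp: LTI_def)
  moreover have "shift ` \<Inter>\<A> \<subseteq> \<Inter>\<A>"
    using assms by (fastforce simp: LTI_def)
  ultimately show ?thesis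
    by (simp add: LTI_def)
qed

lemma mpum_eq_Inter: "mpum D = \<Inter>(unfalsified D)"
  unfolding mpum_def
proof (rule the_equality)
  show least: "\<Inter>(unfalsified D) \<in> LTI \<and> D \<subseteq> \<Inter>(unfalsified D) \<and>
      (\<forall>B'\<in>LTI. D \<subseteq> B' \<longrightarrow> \<Inter>(unfalsified D) \<subseteq> B')"
    using LTI_Inter[of "unfalsified D"] by (auto simp: unfalsified_def)
  show "B = \<Inter>(unfalsified D)"
    if "B \<in> LTI \<and> D \<subseteq> B \<and> (\<forall>B'\<in>LTI. D \<subseteq> B' \<longrightarrow> B \<subseteq> B')" for B
    using that least by (meson subset_antisym)
qed

lemma mpum_unfalsified: "mpum D \<in> unfalsified D"
  using LTI_Inter[of "unfalsified D"] by (auto simp: mpum_eq_Inter unfalsified_def)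

lemma mpum_subset: "B \<in> unfalsified D \<Longrightarrow> mpum D \<subseteq> B"
  by (auto simp: mpum_eq_Inter)

lemma subspace_restr:
  assumes "B \<in> unfalsified D"
  shows "subspace (restr B)"
proof -
  have "linear (\<lambda>w :: nat \<Rightarrow> real ^ 'q. (\<chi> i. w (card {j. j < i})) :: ('q, 'l::{finite,linorder}) window)"
    by (rule linearI) (simp_all add: vec_eq_iff scaleR_fun_def plus_fun_def)
  moreover have "subspace B"
    using assms by (simp add: unfalsified_def LTI_def)
  ultimately show ?thesis
    unfolding restr_def by (rule linear_subspace_image)
qed

lemma restr_mono: "B \<subseteq> C \<Longrightarrow> restr B \<subseteq> restr C"
  by (auto simp: restr_def)

section \<open>Principal angles of nested subspaces\<close>

text \<open>The angles are defined by a choice of principal vectors, so existence is what gives access to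
  their properties. An orthonormal basis of the smaller subspace, paired with itself, attains the
  Cauchy--Schwarz bound \<open>1\<close> at every stage.\<close>

lemma principal_vectors_exist_nested:
  fixes V U :: "'a::euclidean_space set"
  assumes "subspace V" "V \<subseteq> U"
  shows "\<exists>v. principal_vectors V U v v"
proof -
  obtain B where B: "B \<subseteq> V" "pairwise orthogonal B" "\<And>x. x \<in> B \<Longrightarrow> norm x = 1"
    "independent B" "card B = dim V"
    using orthonormal_basis_subspace[OF \<open>subspace V\<close>] by metis
  have "finite B"
    using \<open>independent B\<close> by (rule finiteI_independent)
  then obtain v where v: "bij_betw v {0..<dim V} B"
    using ex_bij_betw_nat_finite B(5) by metis
  have vB: "v i \<in> B" if "i < dim V" for i
    using v that by (auto simp: bij_betw_def)
  have orth: "v i \<bullet> v j = 0" if "i < dim V" "j < i" for i j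
  proof -
    have "v i \<noteq> v j"
      using bij_betw_imp_inj_on[OF v] that by (simp add: inj_on_eq_iff)
    then show ?thesis
      using B(2) vB that by (auto simp: pairwise_def orthogonal_def)
  qed
  have "x \<bullet> y \<le> 1" if "norm x = 1" "norm y = 1" for x y :: 'a
    using norm_cauchy_schwarz[of x y] that by simp
  moreover have "v i \<bullet> v i = 1" if "i < dim V" for i
    using B(3) vB that by (simp add: norm_eq_1)
  ultimately have "principal_vectors V U v v"
    unfolding principal_vectors_def is_arg_max_def
    using vB B(1,3) orth \<open>V \<subseteq> U\<close> by (fastforce simp: not_less)
  then show ?thesis
    by blast
qed

lemma exists_unit_vector_orthogonal_to_few:
  fixes V :: "'a::euclidean_space set"
  assumes "subspace V" "i < dim V" "\<And>j. j < i \<Longrightarrow> v j \<in> V"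
  obtains x where "x \<in> V" "norm x = 1" "\<And>j. j < i \<Longrightarrow> x \<bullet> v j = 0"
proof -
  have "dim (v ` {..<i}) \<le> card (v ` {..<i})"
    by (rule dim_le_card') simp
  also have "\<dots> \<le> i"
    using card_image_le[of "{..<i}" v] by simp
  finally have "dim (v ` {..<i}) < dim V"
    using \<open>i < dim V\<close> by simp
  then have "span (v ` {..<i}) \<noteq> span V"
    by (metis dim_span less_irrefl)
  moreover have "span (v ` {..<i}) \<subseteq> span V"
    using assms(3) by (intro span_mono) auto
  ultimately have "span (v ` {..<i}) \<subset> span V"
    by blast
  then obtain x where x: "x \<noteq> 0" "x \<in> span V" "\<And>y. y \<in> span (v ` {..<i}) \<Longrightarrow> orthogonal x y"
    using orthogonal_to_subspace_exists_gen by blast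
  show thesis
  proof
    show "sgn x \<in> V"
      using x(2) \<open>subspace V\<close> by (simp add: sgn_div_norm subspace_scale span_eq_iff[THEN iffD2])
    show "norm (sgn x) = 1"
      using x(1) by (simp add: norm_sgn)
    show "sgn x \<bullet> v j = 0" if "j < i" for j
      using x(3)[of "v j"] that by (simp add: sgn_div_norm orthogonal_def span_base)
  qed
qed

text \<open>Principal vectors are far from unique, so the claim has to be shown for every choice.
  As long as all earlier pairs coincide, a unit vector of \<open>V\<close> orthogonal to them may be paired with
  itself, so that the maximal inner product is \<open>1\<close>, and the next pair coincides too.\<close>

lemma principal_vectors_nested_eq:
  fixes V U :: "'a::euclidean_space set"
  assumes "subspace V" "V \<subseteq> U" "principal_vectors V U v u" "i < dim V"
  shows "v i = u i \<and> norm (v i) = 1"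
  using \<open>i < dim V\<close>
proof (induction i rule: less_induct)
  case (less i)
  have "dim V \<le> dim U"
    using \<open>V \<subseteq> U\<close> by (rule dim_subset)
  then have pv: "is_arg_max (\<lambda>(x, y). x \<bullet> y)
      (\<lambda>(x, y). x \<in> V \<and> y \<in> U \<and> norm x = 1 \<and> norm y = 1 \<and> (\<forall>j<k. x \<bullet> v j = 0 \<and> y \<bullet> u j = 0))
      (v k, u k)" if "k \<le> i" for k
    using assms(3) less.prems that by (simp add: principal_vectors_def)
  have "v j \<in> V" if "j < i" for j
    using pv[of j] that by (simp add: is_arg_max_def)
  then obtain x where x: "x \<in> V" "norm x = 1" "\<And>j. j < i \<Longrightarrow> x \<bullet> v j = 0"
    using exists_unit_vector_orthogonal_to_few[OF \<open>subspace V\<close> less.prems] by metis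
  have "x \<bullet> u j = 0" if "j < i" for j
    using x(3)[OF that] less.IH[OF that] that less.prems by simp
  then have "x \<bullet> x \<le> v i \<bullet> u i"
    using pv[of i, unfolded is_arg_max_def] x \<open>V \<subseteq> U\<close>
    by (auto simp: not_less dest!: spec[of _ "(x, x)"] simp del: split_paired_Ex split_paired_All)
  then have "1 \<le> v i \<bullet> u i"
    using x(2) by (simp add: norm_eq_1)
  moreover have unit: "norm (v i) = 1" "norm (u i) = 1"
    using pv[of i] by (simp_all add: is_arg_max_def)
  \<comment> \<open>equality in the Cauchy--Schwarz inequality\<close>
  ultimately have "v i \<bullet> u i = norm (v i) * norm (u i)"
    using norm_cauchy_schwarz[of "v i" "u i"] by simp
  then have "v i = u i"
    using unit norm_cauchy_schwarz_eq[of "v i" "u i"] by simp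
  with unit show ?case
    by simp
qed

lemma principal_angle_nested:
  assumes "subspace V" "V \<subseteq> U" "i < dim V"
  shows "principal_angle V U i = 0"
proof -
  obtain v u where choice: "(SOME (v, u). principal_vectors V U v u) = (v, u)"
    by fastforce
  have "\<exists>p. case p of (v, u) \<Rightarrow> principal_vectors V U v u"
    using principal_vectors_exist_nested[OF assms(1,2)] by auto
  then have "principal_vectors V U v u"
    using someI_ex[of "\<lambda>(v, u). principal_vectors V U v u"] choice by simp
  then have "v i \<bullet> u i = 1"
    using principal_vectors_nested_eq[OF assms(1,2) _ assms(3)] by (metis norm_eq_1)
  then show ?thesis
    by (simp add: principal_angle_def choice)
qed

section \<open>Distance and utility\<close>

lemma alpha_pos: "0 < alpha s"
  by (cases s) simp_all

lemma subspace_dist_sq: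
  "(subspace_dist s V U)\<^sup>2 = (delta s V U)\<^sup>2 + (alpha s)\<^sup>2 * \<bar>real (dim V) - real (dim U)\<bar>"
  by (cases s) (simp_all add: sum_nonneg power_divide)

lemma subspace_dist_nested:
  assumes "subspace V" "V \<subseteq> U"
  shows "(subspace_dist s V U)\<^sup>2 = (alpha s)\<^sup>2 * (real (dim U) - real (dim V))"
proof -
  have "dim V \<le> dim U"
    using \<open>V \<subseteq> U\<close> by (rule dim_subset)
  moreover have "delta s V U = 0"
    by (cases s) (simp_all add: principal_angle_nested[OF assms])
  ultimately show ?thesis
    by (simp add: subspace_dist_sq)
qed

lemma utility_eq_neg_dist:
  fixes D B :: "(nat \<Rightarrow> real ^ 'q) set"
  shows "utility s TYPE('l::{finite,linorder}) D B =
    - (subspace_dist s (restr (mpum D) :: ('q, 'l) window set) (restr B))\<^sup>2"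
proof -
  have "real N * \<bar>a / real N - b / real N\<bar> = \<bar>a - b\<bar>" if "0 < N" for N :: nat and a b :: real
    using that by (simp add: abs_divide flip: diff_divide_distrib)
  from this[of "CARD('q) * CARD('l)"] show ?thesis
    by (simp add: utility_def complexity_def subspace_dist_sq mult.assoc)
qed

lemma is_arg_max_utility_iff:
  fixes D B :: "(nat \<Rightarrow> real ^ 'q) set"
  shows "is_arg_max (utility s TYPE('l::{finite,linorder}) D) P B \<longleftrightarrow>
    is_arg_min (\<lambda>B. (subspace_dist s (restr (mpum D) :: ('q, 'l) window set) (restr B))\<^sup>2) P B"
  by (simp add: is_arg_max_def is_arg_min_def utility_eq_neg_dist)

text \<open>Since the two restrictions are nested, the distance sees only their dimensions; this is enough
  because a proper subspace has smaller dimension.\<close>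

lemma subspace_dist_mpum_eq_0_iff:
  fixes D B :: "(nat \<Rightarrow> real ^ 'q) set"
  assumes "B \<in> unfalsified D"
  shows "(subspace_dist s (restr (mpum D) :: ('q, 'l::{finite,linorder}) window set) (restr B))\<^sup>2 = 0
    \<longleftrightarrow> (restr B :: ('q, 'l) window set) = restr (mpum D)"
proof -
  define V U :: "('q, 'l) window set" where "V = restr (mpum D)" and "U = restr B"
  have "subspace V" "subspace U" "V \<subseteq> U"
    unfolding V_def U_def
    using subspace_restr mpum_unfalsified assms restr_mono mpum_subset by blast+
  have "(subspace_dist s V U)\<^sup>2 = 0 \<longleftrightarrow> dim U = dim V"
    using subspace_dist_nested[OF \<open>subspace V\<close> \<open>V \<subseteq> U\<close>] alpha_pos[of s] by simp
  also have "\<dots> \<longleftrightarrow> U = V"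
    using subspace_dim_equal[OF \<open>subspace V\<close> \<open>subspace U\<close> \<open>V \<subseteq> U\<close>] by auto
  finally show ?thesis
    by (simp only: V_def U_def)
qed

theorem corollary1:
  fixes D :: "(nat \<Rightarrow> real ^ 'q) set" and s :: variant
  shows
    "is_arg_max (utility s TYPE('l::{finite,linorder}) D) (\<lambda>B. B \<in> unfalsified D) (mpum D) \<and>
     is_arg_min (\<lambda>B. (subspace_dist s (restr (mpum D) :: ('q, 'l) window set) (restr B))\<^sup>2)
       (\<lambda>B. B \<in> unfalsified D) (mpum D) \<and>
     (\<forall>B\<in>unfalsified D.
        is_arg_max (utility s TYPE('l) D) (\<lambda>B. B \<in> unfalsified D) B \<or>
        is_arg_min (\<lambda>B. (subspace_dist s (restr (mpum D) :: ('q, 'l) window set) (restr B))\<^sup>2)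
          (\<lambda>B. B \<in> unfalsified D) B \<longrightarrow>
        (restr B :: ('q, 'l) window set) = restr (mpum D))"
proof -
  let ?d = "\<lambda>B. (subspace_dist s (restr (mpum D) :: ('q, 'l) window set) (restr B))\<^sup>2"
  have min: "?d (mpum D) = 0"
    using subspace_dist_mpum_eq_0_iff[OF mpum_unfalsified] by blast
  then have opt: "is_arg_min ?d (\<lambda>B. B \<in> unfalsified D) (mpum D)"
    by (simp add: is_arg_min_def mpum_unfalsified not_less)
  have "(restr B :: ('q, 'l) window set) = restr (mpum D)"
    if "B \<in> unfalsified D" "is_arg_min ?d (\<lambda>B. B \<in> unfalsified D) B" for B
  proof -
    have "\<not> 0 < ?d B"
      using that(2) min mpum_unfalsified[of D] by (auto simp: is_arg_min_def)
    then have "?d B = 0"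
      by (simp add: order_antisym)
    then show ?thesis
      using subspace_dist_mpum_eq_0_iff[OF that(1)] by blast
  qed
  with opt show ?thesis
    unfolding is_arg_max_utility_iff by blast
qed

end
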